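(* Let $\Delta\ge 3$. Any algorithm (deterministic or randomized) that maintains a proper $\Delta$-edge-coloring of a fully dynamic forest of maximum degree at most $\Delta$ on $n$ vertices, even of a rooted forest, has amortized recourse $\Omega(\log_{\Delta-1} n)$ on some update sequence.
   Context: A dynamic forest on $n$ fixed vertices starts empty; each update inserts an edge joining two distinct trees or deletes an existing edge; the maximum degree stays at most $\Delta$. In the rooted variant each tree has an assigned root, an insertion $(p,r)$ requires $r$ to be a root and makes $r$ a child of $p$, and deleting an edge $(p,r)$ with $p$ the parent of $r$ makes $r$ the root of the new tree. The palette is $[\Delta]$. Recourse of an update is the number of previously colored edges whose color changes (coloring the new edge does not count); amortized recourse is total recourse divided by number of updates. *)

theory Defs
  imports "HOL-Probability.Probability"
begin

type_synonym edge = "nat set"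
type_synonym coloring = "edge \<Rightarrow> nat"

text \<open>
  The vertices are \<open>0, \<dots>, n - 1\<close>. An update names an object of type \<open>'e\<close>: an undirected edge
  \<open>{u, v}\<close> in the plain model, a pair (parent, child) in the rooted model.
\<close>

datatype 'e update = Insert 'e | Delete 'e

fun apply_update :: "'e set \<Rightarrow> 'e update \<Rightarrow> 'e set" where
  "apply_update E (Insert e) = insert e E"
| "apply_update E (Delete e) = E - {e}"

definition state :: "'e update list \<Rightarrow> 'e set" where
  "state us = foldl apply_update {} us"

definition degree :: "edge set \<Rightarrow> nat \<Rightarrow> nat" where
  "degree E v = card {e \<in> E. v \<in> e}"

definition same_tree :: "edge set \<Rightarrow> nat \<Rightarrow> nat \<Rightarrow> bool" where
  "same_tree E u v \<longleftrightarrow> (u, v) \<in> {(x, y). {x, y} \<in> E}\<^sup>*"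

fun forest_legal :: "nat \<Rightarrow> nat \<Rightarrow> edge set \<Rightarrow> edge update \<Rightarrow> bool" where
  "forest_legal n \<Delta> E (Insert e) \<longleftrightarrow>
     (\<exists>u<n. \<exists>v<n. e = {u, v} \<and> \<not> same_tree E u v) \<and> (\<forall>w. degree (insert e E) w \<le> \<Delta>)"
| "forest_legal n \<Delta> E (Delete e) \<longleftrightarrow> e \<in> E"

text \<open>
  A rooted forest is its set of pairs (parent, child); its roots are the vertices without a parent.
  Inserting or deleting a pair then changes the roots as required: an inserted child stops being a
  root, and the child of a deleted pair becomes the root of the tree that is split off.
\<close>

definition underlying :: "(nat \<times> nat) set \<Rightarrow> edge set" where
  "underlying F = (\<lambda>(p, r). {p, r}) ` F"

fun rooted_legal :: "nat \<Rightarrow> nat \<Rightarrow> (nat \<times> nat) set \<Rightarrow> (nat \<times> nat) update \<Rightarrow> bool" where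
  "rooted_legal n \<Delta> F (Insert (p, r)) \<longleftrightarrow>
     (\<forall>q. (q, r) \<notin> F) \<and> forest_legal n \<Delta> (underlying F) (Insert {p, r})"
| "rooted_legal n \<Delta> F (Delete (p, r)) \<longleftrightarrow> (p, r) \<in> F"

definition legal_seq :: "('e set \<Rightarrow> 'e update \<Rightarrow> bool) \<Rightarrow> 'e update list \<Rightarrow> bool" where
  "legal_seq legal us \<longleftrightarrow> (\<forall>i<length us. legal (state (take i us)) (us ! i))"

definition proper_edge_coloring :: "nat \<Rightarrow> edge set \<Rightarrow> coloring \<Rightarrow> bool" where
  "proper_edge_coloring \<Delta> E col \<longleftrightarrow>
     col ` E \<subseteq> {1..\<Delta>} \<and>
     (\<forall>e\<in>E. \<forall>f\<in>E. e \<noteq> f \<and> e \<inter> f \<noteq> {} \<longrightarrow> col e \<noteq> col f)"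

text \<open>
  A deterministic online algorithm is a function from the updates seen so far to the coloring it
  currently maintains; the values of this coloring outside the current edge set are irrelevant.
  The parameter \<open>g\<close> below maps a state to its undirected edge set: it is \<^const>\<open>id\<close> in the plain
  model and \<^const>\<open>underlying\<close> in the rooted one.
\<close>

type_synonym 'e algorithm = "'e update list \<Rightarrow> coloring"

definition maintains_coloring ::
  "('e set \<Rightarrow> 'e update \<Rightarrow> bool) \<Rightarrow> ('e set \<Rightarrow> edge set) \<Rightarrow> nat \<Rightarrow> 'e algorithm \<Rightarrow> bool" where
  "maintains_coloring legal g \<Delta> A \<longleftrightarrow>
     (\<forall>us. legal_seq legal us \<longrightarrow> proper_edge_coloring \<Delta> (g (state us)) (A us))"

text \<open>
  A randomized algorithm is a probability measure on deterministic algorithms, i.e. the law of the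
  algorithm obtained by fixing the random choices. Measurability is only required of the colors
  of edges that are present.
\<close>

definition randomized_maintains_coloring ::
  "('e set \<Rightarrow> 'e update \<Rightarrow> bool) \<Rightarrow> ('e set \<Rightarrow> edge set) \<Rightarrow> nat \<Rightarrow> 'e algorithm measure \<Rightarrow> bool" where
  "randomized_maintains_coloring legal g \<Delta> M \<longleftrightarrow>
     prob_space M \<and>
     (\<forall>us. legal_seq legal us \<longrightarrow>
        (\<forall>e\<in>g (state us). (\<lambda>A. A us e) \<in> measurable M (count_space UNIV))) \<and>
     (\<forall>A\<in>space M. maintains_coloring legal g \<Delta> A)"

text \<open>
  Intersecting the edge sets before and after the update excludes exactly the edge that is being
  inserted or deleted.
\<close>

definition recourse :: "('e set \<Rightarrow> edge set) \<Rightarrow> 'e algorithm \<Rightarrow> 'e update list \<Rightarrow> 'e update \<Rightarrow> nat" where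
  "recourse g A us u =
     card {e \<in> g (state us) \<inter> g (state (us @ [u])). A us e \<noteq> A (us @ [u]) e}"

definition amortized_recourse :: "('e set \<Rightarrow> edge set) \<Rightarrow> 'e algorithm \<Rightarrow> 'e update list \<Rightarrow> real" where
  "amortized_recourse g A us =
     real (\<Sum>i<length us. recourse g A (take i us) (us ! i)) / real (length us)"

end

theory Submission
  imports Defs
begin

text \<open>
  Let \<open>d = \<Delta> - 1\<close>. Take two balanced \<open>d\<close>-ary trees rooted at \<open>0\<close> and \<open>1\<close> and an isolated
  vertex \<open>v\<close>. Each inner vertex other than the two roots has degree \<open>\<Delta>\<close>, and each root misses
  exactly one color. Inserting \<open>{v, 0}\<close> and \<open>{v, 1}\<close> forces the colors missing at the two roots
  to be distinct; deleting both edges and inserting \<open>{0, 1}\<close> forces them to be equal. So one of the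
  roots changes its missing color, and such a change propagates down to a leaf, recoloring at least
  as many edges as the least depth of a leaf. Repeating these six updates amortizes the construction of the
  trees. The sequence does not depend on the algorithm, so it works for randomized algorithms too.
\<close>

section \<open>Update sequences and recourse\<close>

lemma state_Nil [simp]: "state [] = {}"
  by (simp add: state_def)

lemma state_append [simp]: "state (us @ ws) = foldl apply_update (state us) ws"
  by (simp add: state_def)

lemma finite_state: "finite (state us)"
proof (induction us rule: rev_induct)
  case (snoc u us)
  then show ?case by (cases u) auto
qed simp

lemma finite_underlying_state: "finite (underlying (state us))"
  by (simp add: underlying_def finite_state)

text \<open>Legality of a block relative to a starting state: one check of a block then serves every
  history that ends in that state.\<close>

fun legal_from :: "('e set \<Rightarrow> 'e update \<Rightarrow> bool) \<Rightarrow> 'e set \<Rightarrow> 'e update list \<Rightarrow> bool" where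
  "legal_from legal E [] \<longleftrightarrow> True"
| "legal_from legal E (u # us) \<longleftrightarrow> legal E u \<and> legal_from legal (apply_update E u) us"

lemma legal_seq_Nil [simp]: "legal_seq legal []"
  by (simp add: legal_seq_def)

lemma legal_seq_snoc [simp]:
  "legal_seq legal (us @ [u]) \<longleftrightarrow> legal_seq legal us \<and> legal (state us) u"
  by (auto simp: legal_seq_def nth_append less_Suc_eq)

lemma legal_seq_append:
  "legal_seq legal (us @ ws) \<longleftrightarrow> legal_seq legal us \<and> legal_from legal (state us) ws"
proof (induction ws arbitrary: us)
  case (Cons w ws)
  show ?case
    using Cons[of "us @ [w]"] by simp
qed simp

lemma legal_seq_take: "legal_seq legal us \<Longrightarrow> legal_seq legal (take i us)"
  by (metis append_take_drop_id legal_seq_append)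

definition total_recourse :: "('e set \<Rightarrow> edge set) \<Rightarrow> 'e algorithm \<Rightarrow> 'e update list \<Rightarrow> nat" where
  "total_recourse g A us = (\<Sum>i<length us. recourse g A (take i us) (us ! i))"

lemma amortized_recourse_eq:
  "amortized_recourse g A us = real (total_recourse g A us) / real (length us)"
  by (simp add: amortized_recourse_def total_recourse_def)

lemma total_recourse_snoc:
  "total_recourse g A (us @ [u]) = total_recourse g A us + recourse g A us u"
  by (simp add: total_recourse_def nth_append)

lemma total_recourse_mono: "total_recourse g A us \<le> total_recourse g A (us @ ws)"
proof (induction ws rule: rev_induct)
  case (snoc w ws)
  then show ?case
    using total_recourse_snoc[of g A "us @ ws" w] by simp
qed simp

text \<open>An edge of \<open>X\<close> with different colors before and after \<open>ws\<close>
  changes color at some single update of \<open>ws\<close>. It is present on both sides of that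
  update, so the recourse counts it there.\<close>

lemma card_changed_le_total_recourse:
  assumes "\<And>i. i \<le> length ws \<Longrightarrow> X \<subseteq> g (state (us @ take i ws))"
    and fin: "\<And>us. finite (g (state us))"
  shows "total_recourse g A us + card {e \<in> X. A us e \<noteq> A (us @ ws) e}
    \<le> total_recourse g A (us @ ws)"
  using assms(1)
proof (induction ws rule: rev_induct)
  case (snoc w ws)
  have X1: "X \<subseteq> g (state (us @ ws))"
    using snoc.prems[of "length ws"] by simp
  have X2: "X \<subseteq> g (state ((us @ ws) @ [w]))"
    using snoc.prems[of "Suc (length ws)"] by simp
  have finX: "finite X"
    using X1 fin finite_subset by blast
  have IH: "total_recourse g A us + card {e \<in> X. A us e \<noteq> A (us @ ws) e}
    \<le> total_recourse g A (us @ ws)"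
  proof (rule snoc.IH)
    fix i assume "i \<le> length ws"
    then show "X \<subseteq> g (state (us @ take i ws))"
      using snoc.prems[of i] by simp
  qed
  let ?Y = "{e \<in> X. A (us @ ws) e \<noteq> A ((us @ ws) @ [w]) e}"
  have "card ?Y \<le> recourse g A (us @ ws) w"
    unfolding recourse_def by (rule card_mono) (use X1 X2 fin[of "us @ ws"] in auto)
  moreover have "card {e \<in> X. A us e \<noteq> A (us @ ws @ [w]) e}
      \<le> card ({e \<in> X. A us e \<noteq> A (us @ ws) e} \<union> ?Y)"
    by (rule card_mono) (use finX in auto)
  moreover have "\<dots> \<le> card {e \<in> X. A us e \<noteq> A (us @ ws) e} + card ?Y"
    by (rule card_Un_le)
  ultimately show ?case
    using IH total_recourse_snoc[of g A "us @ ws" w] by simp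
qed simp

section \<open>Randomized algorithms\<close>

lemma integrable_recourse:
  fixes M :: "'e algorithm measure"
  assumes M: "prob_space M"
    and meas: "\<And>e. e \<in> g (state us) \<Longrightarrow> (\<lambda>A. A us e) \<in> measurable M (count_space UNIV)"
    "\<And>e. e \<in> g (state (us @ [u])) \<Longrightarrow> (\<lambda>A. A (us @ [u]) e) \<in> measurable M (count_space UNIV)"
    and fin: "finite (g (state us))"
  shows "integrable M (\<lambda>A. real (recourse g A us u))"
proof -
  interpret prob_space M by (fact M)
  define X where "X = g (state us) \<inter> g (state (us @ [u]))"
  have finX: "finite X"
    using fin by (simp add: X_def)
  \<comment> \<open>Measurability is given edge by edge, so the recourse is written as a finite sum
    of indicators.\<close>
  have eq: "real (recourse g A us u) = (\<Sum>e\<in>X. if A us e = A (us @ [u]) e then 0 else 1)" for A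
  proof -
    have "(\<Sum>e\<in>X. if A us e = A (us @ [u]) e then 0 else 1)
      = (\<Sum>e\<in>X. if A us e \<noteq> A (us @ [u]) e then 1 else (0::real))"
      by (rule sum.cong) auto
    also have "\<dots> = real (recourse g A us u)"
      using finX by (simp add: recourse_def X_def flip: sum.inter_filter)
    finally show ?thesis by simp
  qed
  have "integrable M (\<lambda>A. if A us e = A (us @ [u]) e then 0 else (1::real))" if "e \<in> X" for e
  proof (rule integrable_const_bound[where B = 1])
    have [measurable]: "(\<lambda>A. A us e) \<in> measurable M (count_space UNIV)"
      "(\<lambda>A. A (us @ [u]) e) \<in> measurable M (count_space UNIV)"
      using that meas by (auto simp: X_def)
    show "(\<lambda>A. if A us e = A (us @ [u]) e then 0 else (1::real)) \<in> borel_measurable M"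
      by measurable
  qed auto
  then show ?thesis
    unfolding eq by (rule Bochner_Integration.integrable_sum)
qed

text \<open>As \<open>us\<close> is fixed before the algorithm, the bound holds pointwise on the
  sample space and survives integration against a probability measure. Integrability has to be shown
  because the integral of a non-integrable function is 0 by convention.\<close>

lemma randomized_lower_bound:
  assumes M: "randomized_maintains_coloring legal g \<Delta> M"
    and legal: "legal_seq legal us"
    and fin: "\<And>us. finite (g (state us))"
    and bound: "\<And>A. maintains_coloring legal g \<Delta> A \<Longrightarrow> b \<le> amortized_recourse g A us"
  shows "b \<le> (\<integral>A. amortized_recourse g A us \<partial>M)"
proof -
  interpret prob_space M
    using M by (simp add: randomized_maintains_coloring_def)
  have meas: "(\<lambda>A. A ws e) \<in> measurable M (count_space UNIV)"
    if "legal_seq legal ws" "e \<in> g (state ws)" for ws e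
    using M that unfolding randomized_maintains_coloring_def by blast
  have "integrable M (\<lambda>A. real (recourse g A (take i us) (us ! i)))" if "i < length us" for i
  proof (rule integrable_recourse)
    fix e assume "e \<in> g (state (take i us @ [us ! i]))"
    with that show "(\<lambda>A. A (take i us @ [us ! i]) e) \<in> measurable M (count_space UNIV)"
      using meas[OF legal_seq_take[OF legal]] by (metis take_Suc_conv_app_nth)
  qed (use meas[OF legal_seq_take[OF legal]] fin prob_space_axioms in auto)
  then have "integrable M (\<lambda>A. amortized_recourse g A us)"
    unfolding amortized_recourse_def of_nat_sum
    by (intro integrable_divide_zero Bochner_Integration.integrable_sum) auto
  then show ?thesis
    by (rule integral_ge_const)
      (use M bound in \<open>auto simp: randomized_maintains_coloring_def intro!: AE_I2\<close>)
qed

section \<open>From rooted to plain forests\<close>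

abbreviation unroot :: "(nat \<times> nat) update list \<Rightarrow> edge update list" where
  "unroot us \<equiv> map (map_update (\<lambda>(p, r). {p, r})) us"

text \<open>Injectivity is carried through the induction for the sake of deletions: if
  \<open>(p, r)\<close> and \<open>(r, p)\<close> were both present, deleting one would leave
  \<open>{p, r}\<close> in the underlying forest, and the two models would diverge.\<close>

lemma rooted_legal_unroot:
  assumes "legal_seq (rooted_legal n \<Delta>) us"
  shows "legal_seq (forest_legal n \<Delta>) (unroot us) \<and> state (unroot us) = underlying (state us)
    \<and> inj_on (\<lambda>(p, r). {p, r}) (state us)"
  using assms
proof (induction us rule: rev_induct)
  case Nil
  then show ?case by (simp add: underlying_def)
next
  case (snoc u us)
  then have IH: "legal_seq (forest_legal n \<Delta>) (unroot us)" "state (unroot us) = underlying (state us)"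
      "inj_on (\<lambda>(p, r). {p, r}) (state us)"
    and u: "rooted_legal n \<Delta> (state us) u"
    by auto
  show ?case
  proof (cases u)
    case (Insert e)
    obtain p r where e: "e = (p, r)" by fastforce
    have ins: "forest_legal n \<Delta> (underlying (state us)) (Insert {p, r})"
      using u Insert e by simp
    then obtain x y where xy: "{p, r} = {x, y}" "\<not> same_tree (underlying (state us)) x y"
      by auto
    \<comment> \<open>An edge already present would put \<open>p\<close> and \<open>r\<close> into
      the same tree.\<close>
    have "{p, r} \<notin> underlying (state us)"
    proof
      assume "{p, r} \<in> underlying (state us)"
      with xy show False
        unfolding same_tree_def by (metis (mono_tags, lifting) CollectI case_prodI r_into_rtrancl)
    qed
    then have "inj_on (\<lambda>(p, r). {p, r}) (insert (p, r) (state us))"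
      using IH(3) by (auto simp: underlying_def)
    then show ?thesis
      using IH ins Insert e by (simp add: underlying_def)
  next
    case (Delete e)
    obtain p r where e: "e = (p, r)" by fastforce
    have pr: "(p, r) \<in> state us"
      using u Delete e by simp
    have "underlying (state us - {(p, r)}) = underlying (state us) - {{p, r}}"
      unfolding underlying_def using inj_on_image_set_diff[OF IH(3), of "state us" "{(p, r)}"] pr by simp
    then show ?thesis
      using IH pr Delete e by (auto simp: underlying_def intro: inj_on_subset)
  qed
qed

text \<open>Forgetting orientations turns a plain algorithm into a rooted one, so a lower bound for
  rooted forests transfers to plain forests.\<close>

lemma maintains_coloring_unroot:
  assumes "maintains_coloring (forest_legal n \<Delta>) id \<Delta> A"
  shows "maintains_coloring (rooted_legal n \<Delta>) underlying \<Delta> (\<lambda>us. A (unroot us))"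
  using assms rooted_legal_unroot unfolding maintains_coloring_def by (metis id_apply)

lemma amortized_recourse_unroot:
  assumes "legal_seq (rooted_legal n \<Delta>) us"
  shows "amortized_recourse id A (unroot us) = amortized_recourse underlying (\<lambda>us. A (unroot us)) us"
proof -
  have "recourse id A (take i (unroot us)) (unroot us ! i)
      = recourse underlying (\<lambda>us. A (unroot us)) (take i us) (us ! i)" if i: "i < length us" for i
  proof -
    have "legal_seq (rooted_legal n \<Delta>) (take i us @ [us ! i])"
      using legal_seq_take[OF assms, of "Suc i"] i by (simp add: take_Suc_conv_app_nth)
    note rooted_legal_unroot[OF this]
    moreover note rooted_legal_unroot[OF legal_seq_take[OF assms, of i]]
    ultimately show ?thesis
      using i by (simp add: recourse_def take_map)
  qed
  then show ?thesis
    by (simp add: amortized_recourse_def)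
qed

section \<open>Insertions into a rooted forest\<close>

definition incidence :: "(nat \<times> nat) set \<Rightarrow> nat \<Rightarrow> nat" where
  "incidence F w = card {e \<in> F. fst e = w \<or> snd e = w}"

lemma degree_le_incidence:
  assumes "finite F"
  shows "degree (underlying F) w \<le> incidence F w"
proof -
  have "{e \<in> underlying F. w \<in> e} \<subseteq> (\<lambda>(p, r). {p, r}) ` {e \<in> F. fst e = w \<or> snd e = w}"
    by (auto simp: underlying_def)
  then show ?thesis
    unfolding degree_def incidence_def using assms by (intro surj_card_le) auto
qed

lemma incidence_insert_le:
  assumes "finite F"
  shows "incidence (insert (p, r) F) w \<le> incidence F w + (if w = p \<or> w = r then 1 else 0)"
proof -
  have "{e \<in> insert (p, r) F. fst e = w \<or> snd e = w} =
    (if w = p \<or> w = r then insert (p, r) {e \<in> F. fst e = w \<or> snd e = w}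
     else {e \<in> F. fst e = w \<or> snd e = w})"
    by auto
  then show ?thesis
    using assms by (simp add: incidence_def card_insert_if)
qed

text \<open>A labeling that is constant along edges is constant on components, so different labels
  certify different trees without an analysis of paths.\<close>

lemma not_same_tree:
  assumes "\<And>x y. {x, y} \<in> E \<Longrightarrow> f x = f y" and "f u \<noteq> f v"
  shows "\<not> same_tree E u v"
proof
  assume "same_tree E u v"
  then have "(u, v) \<in> {(x, y). {x, y} \<in> E}\<^sup>*"
    by (simp add: same_tree_def)
  then have "f u = f v"
    by induction (use assms in auto)
  with assms show False by simp
qed

lemma rooted_legal_Insert:
  assumes "p < n" "r < n" "finite F" "\<And>q. (q, r) \<notin> F"
    and f: "\<And>x y. (x, y) \<in> F \<Longrightarrow> f x = f y" "f p \<noteq> f r"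
    and deg: "\<And>w. incidence (insert (p, r) F) w \<le> \<Delta>"
  shows "rooted_legal n \<Delta> F (Insert (p, r))"
proof -
  have "f x = f y" if "{x, y} \<in> underlying F" for x y
    using that f(1) unfolding underlying_def by (fastforce simp: doubleton_eq_iff)
  then have "\<not> same_tree (underlying F) p r"
    using f(2) not_same_tree by blast
  moreover have "degree (insert {p, r} (underlying F)) w \<le> \<Delta>" for w
    using degree_le_incidence[of "insert (p, r) F" w] deg[of w] assms(3)
    by (simp add: underlying_def)
  ultimately show ?thesis
    using assms by auto
qed

section \<open>Two balanced trees\<close>

text \<open>
  The vertices \<open>0\<close> and \<open>1\<close> are the roots, and the children of \<open>x\<close> are the \<open>d\<close> vertices from
  \<open>2 + d * x\<close> on; the vertices below \<open>m\<close> are the inner ones in \<^term>\<open>tree_pairs d (2 + d * m)\<close>.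
\<close>

definition parent :: "nat \<Rightarrow> nat \<Rightarrow> nat" where
  "parent d j = (j - 2) div d"

definition children :: "nat \<Rightarrow> nat \<Rightarrow> nat set" where
  "children d x = {2 + d * x..<2 + d * x + d}"

definition tree_pairs :: "nat \<Rightarrow> nat \<Rightarrow> (nat \<times> nat) set" where
  "tree_pairs d i = (\<lambda>j. (parent d j, j)) ` {2..<i}"

lemma parent_less: "2 \<le> j \<Longrightarrow> parent d j < j"
  unfolding parent_def using div_le_dividend[of "j - 2" d] by linarith

text \<open>A component label for use with \<open>not_same_tree\<close>: constant along tree edges,
  0 on one tree and 1 on the other.\<close>

function top_ancestor :: "nat \<Rightarrow> nat \<Rightarrow> nat" where
  "top_ancestor d j = (if j < 2 then j else top_ancestor d (parent d j))"
  by auto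
termination
  by (relation "Wellfounded.measure snd") (auto simp: parent_less)

declare top_ancestor.simps [simp del]

lemma top_ancestor_root: "j < 2 \<Longrightarrow> top_ancestor d j = j"
  by (simp add: top_ancestor.simps)

lemma top_ancestor_parent: "2 \<le> j \<Longrightarrow> top_ancestor d (parent d j) = top_ancestor d j"
  by (simp add: top_ancestor.simps[of d j])

lemma finite_tree_pairs: "finite (tree_pairs d i)"
  by (simp add: tree_pairs_def)

lemma mem_tree_pairs: "(x, y) \<in> tree_pairs d i \<longleftrightarrow> x = parent d y \<and> 2 \<le> y \<and> y < i"
  by (auto simp: tree_pairs_def)

lemma tree_pairs_Suc: "2 \<le> i \<Longrightarrow> tree_pairs d (Suc i) = insert (parent d i, i) (tree_pairs d i)"
  by (simp add: tree_pairs_def atLeastLessThanSuc)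

lemma mem_children_iff:
  assumes "0 < d"
  shows "j \<in> children d x \<longleftrightarrow> 2 \<le> j \<and> parent d j = x"
proof (cases "2 \<le> j")
  case True
  then obtain i where "j = 2 + i"
    using le_Suc_ex by blast
  moreover have "i div d = x \<longleftrightarrow> d * x \<le> i \<and> i < d * x + d"
    using assms by (metis add.commute div_nat_eqI dividend_less_times_div mult.commute mult_Suc_right
        times_div_less_eq_dividend)
  ultimately show ?thesis
    by (auto simp: children_def parent_def)
next
  case False
  then show ?thesis by (auto simp: children_def)
qed

lemma children_less:
  assumes "x < m" "j \<in> children d x"
  shows "j < 2 + d * m"
proof -
  have "d * x + d \<le> d * m"
    using assms(1) by (metis Suc_leI add.commute mult_Suc_right mult_le_mono2)
  with assms(2) show ?thesis by (simp add: children_def)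
qed

text \<open>The parent is the smaller endpoint, so a tree edge can be named by its child.\<close>

lemma tree_edge_inj:
  assumes "2 \<le> i" "2 \<le> j" "{parent d i, i} = {parent d j, j}"
  shows "i = j"
  using assms parent_less[of i d] parent_less[of j d] by (auto simp: doubleton_eq_iff)

text \<open>The roots have no parent pair. This leaves each of them one free slot under the degree
  bound \<open>Suc d\<close>, which the gadget uses.\<close>

lemma incidence_tree_pairs:
  assumes "0 < d"
  shows "incidence (tree_pairs d i) w \<le> d + (if w < 2 then 0 else 1)"
proof -
  let ?S = "Pair w ` children d w"
  let ?P = "if w < 2 then {} else {(parent d w, w)}"
  have "{e \<in> tree_pairs d i. fst e = w \<or> snd e = w} \<subseteq> ?S \<union> ?P"
    by (auto simp: tree_pairs_def mem_children_iff[OF assms])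
  then have "incidence (tree_pairs d i) w \<le> card (?S \<union> ?P)"
    unfolding incidence_def by (intro card_mono) (auto simp: children_def)
  also have "\<dots> \<le> card ?S + card ?P"
    by (rule card_Un_le)
  also have "card ?S = d"
    by (simp add: card_image inj_on_def children_def)
  finally show ?thesis
    by (simp split: if_splits)
qed

lemma incidence_tree_pairs_outside: "2 \<le> w \<Longrightarrow> i \<le> w \<Longrightarrow> incidence (tree_pairs d i) w = 0"
proof -
  assume "2 \<le> w" "i \<le> w"
  then have "{e \<in> tree_pairs d i. fst e = w \<or> snd e = w} = {}"
    using parent_less[of _ d] by (fastforce simp: tree_pairs_def)
  then show ?thesis
    unfolding incidence_def by (metis card.empty)
qed

section \<open>Propagation of a color change down a tree\<close>

lemma proper_edge_coloring_neq:
  assumes "proper_edge_coloring \<Delta> E col" "e \<in> E" "f \<in> E" "e \<noteq> f" "e \<inter> f \<noteq> {}"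
  shows "col e \<noteq> col f"
  using assms by (simp add: proper_edge_coloring_def)

text \<open>Here \<open>c j\<close> stands for the color of the edge from \<open>j\<close> to its
  parent; roots have none, hence \<open>2 \<le> j\<close>. The clauses express properness at the
  inner vertices.\<close>

definition tree_coloring :: "nat \<Rightarrow> nat \<Rightarrow> (nat \<Rightarrow> nat) \<Rightarrow> bool" where
  "tree_coloring d m c \<longleftrightarrow>
     (\<forall>x<m. inj_on c (children d x) \<and> c ` children d x \<subseteq> {1..Suc d}) \<and>
     (\<forall>j. 2 \<le> j \<and> j < m \<longrightarrow> c j \<notin> c ` children d j)"

text \<open>Under \<psi> the \<open>d\<close> child edges of \<open>x\<close> have distinct colors
  among the \<open>d\<close> colors other than \<open>b\<close>, so they use all of these, including
  \<open>a\<close>. Under \<phi> none of them has color \<open>a\<close>, so the one that \<psi>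
  gives color \<open>a\<close> was recolored.\<close>

lemma recolored_child:
  assumes "2 \<le> d" "tree_coloring d m \<psi>" "x < m"
    and "a \<notin> \<phi> ` children d x" "b \<notin> \<psi> ` children d x" "a \<noteq> b" "a \<in> {1..Suc d}" "b \<in> {1..Suc d}"
  obtains j where "j \<in> children d x" "\<psi> j = a" "\<phi> j \<noteq> a" "x < j" "j < 2 + d * m"
proof -
  have \<psi>: "inj_on \<psi> (children d x)" "\<psi> ` children d x \<subseteq> {1..Suc d} - {b}"
    using assms(2,3,5) unfolding tree_coloring_def by blast+
  have "card (\<psi> ` children d x) = card ({1..Suc d} - {b})"
    using \<psi>(1) assms(8) by (simp add: card_image children_def)
  with \<psi>(2) have "\<psi> ` children d x = {1..Suc d} - {b}"
    by (intro card_subset_eq) auto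
  then obtain j where j: "j \<in> children d x" "\<psi> j = a"
    using assms(6,7) by (metis DiffI imageE singletonD)
  show thesis
  proof
    show "j \<in> children d x" "\<psi> j = a"
      by (fact j)+
    show "\<phi> j \<noteq> a"
      using assms(4) j(1) by blast
    show "x < j"
      using parent_less[of j d] mem_children_iff[of d j x] assms(1) j(1) by simp
    show "j < 2 + d * m"
      by (rule children_less[OF assms(3) j(1)])
  qed
qed

text \<open>Descent: at the recolored child \<open>j\<close> the roles of \<open>a\<close> and
  \<open>b\<close> pass to \<open>\<phi> j\<close> and \<open>\<psi> j\<close>, which properness
  bars from the child edges of \<open>j\<close>. The bound on \<open>(x + 3) * d ^ k\<close> keeps
  the next \<open>k\<close> vertices of the path inner; the shift by 3 lets it pass from
  \<open>x\<close> to any child with \<open>k\<close> lowered by one.\<close>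

lemma recoloring_path:
  assumes "2 \<le> d" "tree_coloring d m \<phi>" "tree_coloring d m \<psi>"
    and "(x + 3) * d ^ k \<le> m + 2"
    and "a \<notin> \<phi> ` children d x" "b \<notin> \<psi> ` children d x" "a \<noteq> b" "a \<in> {1..Suc d}" "b \<in> {1..Suc d}"
  shows "Suc k \<le> card {j \<in> {2..<2 + d * m}. x < j \<and> \<phi> j \<noteq> \<psi> j}"
  using assms(4-)
proof (induction k arbitrary: x a b)
  case (0 x a b)
  then have x: "x < m"
    by simp
  obtain j where j: "j \<in> children d x" "\<psi> j = a" "\<phi> j \<noteq> a" "x < j" "j < 2 + d * m"
    using recolored_child[OF assms(1,3) x] 0 by metis
  then have "{j} \<subseteq> {j \<in> {2..<2 + d * m}. x < j \<and> \<phi> j \<noteq> \<psi> j}"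
    by (auto simp: children_def)
  from card_mono[OF _ this] show ?case by simp
next
  case (Suc k x a b)
  have dk: "1 \<le> d ^ k" "1 \<le> d ^ Suc k"
    using assms(1) by simp_all
  have "x + 3 \<le> (x + 3) * d ^ Suc k"
    using mult_le_mono2[OF dk(2), of "x + 3"] by simp
  then have x: "x < m"
    using Suc.prems(1) by linarith
  obtain j where j: "j \<in> children d x" "\<psi> j = a" "\<phi> j \<noteq> a" "x < j" "j < 2 + d * m"
    using recolored_child[OF assms(1,3) x] Suc.prems by metis
  have "2 \<le> j"
    using j(1) by (simp add: children_def)
  have "j + 3 \<le> d * x + d + 4"
    using j(1) by (simp add: children_def)
  \<comment> \<open>This amounts to \<open>4 \<le> 2 * d\<close>.\<close>
  also have "\<dots> \<le> (x + 3) * d"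
    using assms(1) by (simp add: algebra_simps)
  finally have "(j + 3) * d ^ k \<le> (x + 3) * d * d ^ k"
    by (rule mult_le_mono1)
  also have "\<dots> \<le> m + 2"
    using Suc.prems(1) by (simp only: power_Suc mult.assoc)
  finally have jk: "(j + 3) * d ^ k \<le> m + 2" .
  moreover have "j + 3 \<le> (j + 3) * d ^ k"
    using mult_le_mono2[OF dk(1), of "j + 3"] by simp
  ultimately have "j < m"
    by linarith
  then have fresh: "\<phi> j \<notin> \<phi> ` children d j" "\<psi> j \<notin> \<psi> ` children d j"
    using assms(2,3) \<open>2 \<le> j\<close> unfolding tree_coloring_def by blast+
  have "\<phi> j \<in> {1..Suc d}" "\<psi> j \<in> {1..Suc d}"
    using assms(2,3) j(1) x unfolding tree_coloring_def by blast+
  with Suc.IH[OF jk fresh] j(2,3)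
  have "Suc k \<le> card {i \<in> {2..<2 + d * m}. j < i \<and> \<phi> i \<noteq> \<psi> i}"
    by simp
  \<comment> \<open>The set counts only vertices beyond \<open>j\<close>, so \<open>j\<close> is a
    new element.\<close>
  then have "Suc (Suc k) \<le> card (insert j {i \<in> {2..<2 + d * m}. j < i \<and> \<phi> i \<noteq> \<psi> i})"
    by simp
  also have "\<dots> \<le> card {j \<in> {2..<2 + d * m}. x < j \<and> \<phi> j \<noteq> \<psi> j}"
    using j \<open>2 \<le> j\<close> by (intro card_mono) auto
  finally show ?case .
qed

lemma tree_coloring_of_proper:
  assumes "2 \<le> d" "proper_edge_coloring (Suc d) (underlying F) col" "tree_pairs d (2 + d * m) \<subseteq> F"
  shows "tree_coloring d m (\<lambda>j. col {parent d j, j})"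
proof -
  have mem: "{parent d j, j} \<in> underlying F" if "2 \<le> j" "j < 2 + d * m" for j
    using that assms(3) by (force simp: underlying_def tree_pairs_def)
  have ne: "col {parent d i, i} \<noteq> col {parent d j, j}"
    if "2 \<le> i" "i < 2 + d * m" "2 \<le> j" "j < 2 + d * m" "i \<noteq> j"
      "{parent d i, i} \<inter> {parent d j, j} \<noteq> {}" for i j
  proof -
    have "{parent d i, i} \<noteq> {parent d j, j}"
      using that tree_edge_inj by blast
    then show ?thesis
      using proper_edge_coloring_neq[OF assms(2)] mem that by simp
  qed
  have range: "col {parent d j, j} \<in> {1..Suc d}" if "2 \<le> j" "j < 2 + d * m" for j
    using assms(2) mem[OF that] unfolding proper_edge_coloring_def by blast
  have ch: "2 \<le> j \<and> j < 2 + d * m \<and> parent d j = x" if "x < m" "j \<in> children d x" for x j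
    using that children_less[OF that] mem_children_iff[of d j x] assms(1) by simp
  show ?thesis
    unfolding tree_coloring_def
  proof (intro conjI allI impI)
    fix x assume x: "x < m"
    show "inj_on (\<lambda>j. col {parent d j, j}) (children d x)"
    proof (rule inj_onI, rule ccontr)
      fix i j assume ij: "i \<in> children d x" "j \<in> children d x" "i \<noteq> j"
        and eq: "col {parent d i, i} = col {parent d j, j}"
      show False
        using ne[of i j] ch[OF x ij(1)] ch[OF x ij(2)] ij(3) eq by auto
    qed
    show "(\<lambda>j. col {parent d j, j}) ` children d x \<subseteq> {1..Suc d}"
      using ch[OF x] range by blast
  next
    fix j assume j: "2 \<le> j \<and> j < m"
    show "col {parent d j, j} \<notin> (\<lambda>j. col {parent d j, j}) ` children d j"
    proof
      assume "col {parent d j, j} \<in> (\<lambda>j. col {parent d j, j}) ` children d j"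
      then obtain i where i: "i \<in> children d j" "col {parent d j, j} = col {parent d i, i}"
        by auto
      \<comment> \<open>Ensures that the parent edge of the inner vertex \<open>j\<close> is
        present.\<close>
      have "m \<le> d * m"
        using assms(1) by simp
      then have "j < 2 + d * m"
        using j by linarith
      then show False
        using ne[of j i] i ch[of j i] j parent_less[of i d] by auto
    qed
  qed
qed

text \<open>The extra edge meets all \<open>d\<close> child edges at the root \<open>x\<close>, so
  its color is the one missing there. This makes the missing color visible on the edges that the
  gadget inserts.\<close>

lemma extra_edge_color_notin_children:
  assumes "2 \<le> d" "x < 2" "x < m" "y \<notin> children d x"
    and "proper_edge_coloring (Suc d) (underlying F) col" "tree_pairs d (2 + d * m) \<subseteq> F"
    and "{x, y} \<in> underlying F"
  shows "col {x, y} \<notin> (\<lambda>j. col {parent d j, j}) ` children d x"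
proof
  assume "col {x, y} \<in> (\<lambda>j. col {parent d j, j}) ` children d x"
  then obtain j where j: "j \<in> children d x" "col {x, y} = col {parent d j, j}"
    by auto
  have j': "2 \<le> j" "j < 2 + d * m" "parent d j = x"
    using j(1) children_less[OF assms(3) j(1)] mem_children_iff[of d j x] assms(1) by auto
  have "{x, j} \<in> underlying F"
    using j' assms(6) by (force simp: underlying_def tree_pairs_def)
  moreover have "{x, y} \<noteq> {x, j}"
    using assms(2,4) j(1) j' by (auto simp: doubleton_eq_iff)
  ultimately have "col {x, y} \<noteq> col {x, j}"
    using proper_edge_coloring_neq[OF assms(5,7)] by simp
  with j(2) j'(3) show False by simp
qed

section \<open>The hard update sequence\<close>

definition build :: "nat \<Rightarrow> nat \<Rightarrow> (nat \<times> nat) update list" where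
  "build d i = map (\<lambda>j. Insert (parent d j, j)) [2..<i]"

text \<open>Each inserted child is a root at that moment, as the rooted model demands. The final
  deletion restores the initial forest, so the block can be repeated.\<close>

definition gadget :: "nat \<Rightarrow> (nat \<times> nat) update list" where
  "gadget v = [Insert (v, 0), Insert (v, 1), Delete (v, 0), Delete (v, 1), Insert (0, 1), Delete (0, 1)]"

lemma build_legal:
  assumes "2 \<le> d" "i \<le> n"
  shows "legal_seq (rooted_legal n (Suc d)) (build d i) \<and> state (build d i) = tree_pairs d i"
  using assms(2)
proof (induction i)
  case 0
  then show ?case by (simp add: build_def tree_pairs_def)
next
  case (Suc i)
  show ?case
  proof (cases "2 \<le> i")
    case False
    then show ?thesis by (simp add: build_def tree_pairs_def)
  next
    case True
    then have build: "build d (Suc i) = build d i @ [Insert (parent d i, i)]"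
      by (simp add: build_def)
    have IH: "legal_seq (rooted_legal n (Suc d)) (build d i)" "state (build d i) = tree_pairs d i"
      using Suc by auto
    have "rooted_legal n (Suc d) (tree_pairs d i) (Insert (parent d i, i))"
    \<comment> \<open>The vertex \<open>i\<close> is still isolated, so being equal to
      \<open>i\<close> is a component label.\<close>
    proof (rule rooted_legal_Insert[where f = "\<lambda>x. x = i"])
      show "parent d i < n" "i < n"
        using Suc.prems parent_less[OF True, of d] by auto
      show "incidence (insert (parent d i, i) (tree_pairs d i)) w \<le> Suc d" for w
        using incidence_tree_pairs[of d "Suc i" w] assms(1) tree_pairs_Suc[OF True, of d]
        by (simp split: if_splits)
      show "(x = i) = (y = i)" if "(x, y) \<in> tree_pairs d i" for x y
        using that parent_less[of y d] by (auto simp: mem_tree_pairs)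
    qed (use True parent_less[OF True, of d] in \<open>auto simp: mem_tree_pairs finite_tree_pairs\<close>)
    then show ?thesis
      using IH build True by (simp add: tree_pairs_Suc)
  qed
qed

text \<open>The vertex \<open>v\<close> is the first one beyond the trees, hence isolated. Besides
  legality, this records that the trees persist throughout, that the forest is restored, and the two
  states whose colorings \<open>gadget_recourse\<close> compares.\<close>

lemma gadget_legal:
  fixes d m :: nat
  assumes "2 \<le> d" and n: "v < n" and v: "v = 2 + d * m"
  defines "T \<equiv> tree_pairs d v"
  shows "legal_from (rooted_legal n (Suc d)) T (gadget v)"
    and "foldl apply_update T (take i (gadget v)) \<supseteq> T"
    and "foldl apply_update T (gadget v) = T"
    and "foldl apply_update T (take 2 (gadget v)) = insert (v, 1) (insert (v, 0) T)"
    and "foldl apply_update T (take 5 (gadget v)) = insert (0, 1) T"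
proof -
  have finT: "finite T"
    by (simp add: T_def finite_tree_pairs)
  have notin: "(x, 0) \<notin> T" "(x, 1) \<notin> T" "(x, Suc 0) \<notin> T" "(v, x) \<notin> T" "(x, v) \<notin> T" for x
    using parent_less[of x d] by (auto simp: T_def mem_tree_pairs)
  have rest: "insert (v, 1) (insert (v, 0) T) - {(v, 0)} - {(v, 1)} = T" "insert (0, 1) T - {(0, 1)} = T"
    using notin by auto
  have inc: "incidence T w \<le> d + (if w < 2 then 0 else 1)" "incidence T v = 0" for w
    using incidence_tree_pairs[of d v w] incidence_tree_pairs_outside[of v v d] assms(1) v
    by (auto simp: T_def)
  have top: "top_ancestor d x = top_ancestor d y" if "(x, y) \<in> T" for x y
    using that by (simp add: T_def mem_tree_pairs top_ancestor_parent)
  have v2: "2 \<le> v" using v by simp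
  have l1: "rooted_legal n (Suc d) T (Insert (v, 0))"
  proof (rule rooted_legal_Insert[where f = "\<lambda>x. x = v"])
    show "incidence (insert (v, 0) T) w \<le> Suc d" for w
      using incidence_insert_le[OF finT, of v 0 w] inc(1)[of w] inc(2) assms(1)
      by (auto split: if_splits)
    show "(x = v) = (y = v)" if "(x, y) \<in> T" for x y
      using that notin by auto
  qed (use n finT notin v2 in auto)
  have l2: "rooted_legal n (Suc d) (insert (v, 0) T) (Insert (v, 1))"
  \<comment> \<open>By now \<open>v\<close> belongs to the tree of \<open>0\<close>, so its label is
    overridden by 0; the value of \<open>top_ancestor\<close> at \<open>v\<close> would refer to a
    parent edge that is not present.\<close>
  proof (rule rooted_legal_Insert[where f = "(top_ancestor d)(v := 0)"])
    show "incidence (insert (v, 1) (insert (v, 0) T)) w \<le> Suc d" for w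
      using incidence_insert_le[OF finT, of v 0 w] inc(1)[of w] inc(2) assms(1) v2
        incidence_insert_le[of "insert (v, 0) T" v 1 w] finT
      by (auto split: if_splits)
    show "((top_ancestor d)(v := 0)) x = ((top_ancestor d)(v := 0)) y" if "(x, y) \<in> insert (v, 0) T" for x y
      using that notin top[of x y] top_ancestor_root[of 0 d] by auto
    show "((top_ancestor d)(v := 0)) v \<noteq> ((top_ancestor d)(v := 0)) 1"
      using v2 top_ancestor_root[of 1 d] by auto
  qed (use n finT notin v2 in auto)
  have l5: "rooted_legal n (Suc d) T (Insert (0, 1))"
  proof (rule rooted_legal_Insert[where f = "top_ancestor d"])
    show "incidence (insert (0, 1) T) w \<le> Suc d" for w
      using incidence_insert_le[OF finT, of 0 1 w] inc(1)[of w]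
      by (auto split: if_splits)
  qed (use n finT notin v2 top top_ancestor_root in auto)
  show "legal_from (rooted_legal n (Suc d)) T (gadget v)"
    using l1 l2 l5 rest v2 notin by (simp add: gadget_def del: rooted_legal.simps(1))
  show "foldl apply_update T (gadget v) = T"
    "foldl apply_update T (take 2 (gadget v)) = insert (v, 1) (insert (v, 0) T)"
    "foldl apply_update T (take 5 (gadget v)) = insert (0, 1) T"
    using rest by (simp_all add: gadget_def)
  show "T \<subseteq> foldl apply_update T (take i (gadget v))"
    using notin by (auto simp: gadget_def take_Cons')
qed

text \<open>The colorings compared are those after two and after five of the six updates. The first
  shows the missing color of each root on its edge to \<open>v\<close>, the second shows both on
  \<open>{0, 1}\<close>. All tree edges are present in between, so each one colored differently is
  charged.\<close>

lemma gadget_recourse: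
  fixes d m :: nat
  assumes "2 \<le> d" "v < n" and v: "v = 2 + d * m" and k: "4 * d ^ k \<le> m + 2"
    and A: "maintains_coloring (rooted_legal n (Suc d)) underlying (Suc d) A"
    and us: "legal_seq (rooted_legal n (Suc d)) us" "state us = tree_pairs d v"
  shows "total_recourse underlying A us + Suc k \<le> total_recourse underlying A (us @ gadget v)"
proof -
  note gad = gadget_legal[OF assms(1,2) v]
  define ws where "ws = us @ take 2 (gadget v)"
  define zs where "zs = take 3 (drop 2 (gadget v))"
  have ws_zs: "ws @ zs = us @ take 5 (gadget v)"
    by (simp add: ws_def zs_def gadget_def)
  have leg: "legal_seq (rooted_legal n (Suc d)) (us @ take i (gadget v))" for i
  proof -
    have "legal_seq (rooted_legal n (Suc d)) (us @ gadget v)"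
      using us gad(1) by (simp add: legal_seq_append)
    from legal_seq_take[OF this, of "length us + i"] show ?thesis by simp
  qed
  have st: "state (us @ take i (gadget v)) \<supseteq> tree_pairs d v" for i
    using gad(2) us by simp
  have st_ws: "state ws = insert (v, 1) (insert (v, 0) (tree_pairs d v))"
    using gad(4) us by (simp add: ws_def)
  have st_zs: "state (ws @ zs) = insert (0, 1) (tree_pairs d v)"
    unfolding ws_zs using gad(5) us by simp
  have "d ^ k \<ge> 1"
    using assms(1) by simp
  \<comment> \<open>Both roots are thus inner vertices.\<close>
  then have m: "2 \<le> m"
    using k by linarith
  define \<phi> where "\<phi> = (\<lambda>j. A ws {parent d j, j})"
  define \<psi> where "\<psi> = (\<lambda>j. A (ws @ zs) {parent d j, j})"
  have prop1: "proper_edge_coloring (Suc d) (underlying (state ws)) (A ws)"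
    using A leg[of 2] by (auto simp: maintains_coloring_def ws_def)
  have prop2: "proper_edge_coloring (Suc d) (underlying (state (ws @ zs))) (A (ws @ zs))"
    using A leg[of 5] unfolding maintains_coloring_def ws_zs by blast
  have sub1: "tree_pairs d (2 + d * m) \<subseteq> state ws" and sub2: "tree_pairs d (2 + d * m) \<subseteq> state (ws @ zs)"
    unfolding st_ws st_zs by (auto simp: v)
  have tc: "tree_coloring d m \<phi>" "tree_coloring d m \<psi>"
    unfolding \<phi>_def \<psi>_def
    using tree_coloring_of_proper[OF assms(1) prop1 sub1] tree_coloring_of_proper[OF assms(1) prop2 sub2]
    by simp_all
  have vx: "v \<notin> children d x" if "x < 2" for x
    using children_less[of x m v d] m v that by auto
  have e1: "{0, v} \<in> underlying (state ws)" "{1, v} \<in> underlying (state ws)"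
    unfolding st_ws by (auto simp: underlying_def insert_commute)
  have e2: "{0, 1} \<in> underlying (state (ws @ zs))" "{1, 0} \<in> underlying (state (ws @ zs))"
    unfolding st_zs by (auto simp: underlying_def)
  have r1: "A ws {x, v} \<notin> \<phi> ` children d x" "A ws {x, v} \<in> {1..Suc d}" if "x < 2" for x
  proof -
    have mem: "{x, v} \<in> underlying (state ws)"
      using e1 that by (auto simp: less_2_cases_iff)
    show "A ws {x, v} \<notin> \<phi> ` children d x"
      unfolding \<phi>_def using m that
      by (intro extra_edge_color_notin_children[OF assms(1) that _ vx prop1 sub1 mem]) auto
    show "A ws {x, v} \<in> {1..Suc d}"
      using prop1 mem unfolding proper_edge_coloring_def by blast
  qed
  have r2: "A (ws @ zs) {0, 1} \<notin> \<psi> ` children d x" if "x < 2" for x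
  proof -
    \<comment> \<open>For \<open>x < 2\<close>, \<open>1 - x\<close> is the other root.\<close>
    have "1 - x \<notin> children d x" by (simp add: children_def)
    moreover have "{x, 1 - x} = {0, 1}"
      using that by (auto simp: less_2_cases_iff)
    ultimately show ?thesis
      unfolding \<psi>_def using m that e2
        extra_edge_color_notin_children[OF assms(1) that _ _ prop2 sub2, of "1 - x"] by auto
  qed
  have r3: "A (ws @ zs) {0, 1} \<in> {1..Suc d}"
    using prop2 e2(1) unfolding proper_edge_coloring_def by blast
  have "{0, v} \<noteq> {1, v}" "{0, v} \<inter> {1, v} \<noteq> {}"
    by (auto simp: doubleton_eq_iff)
  then have "A ws {0, v} \<noteq> A ws {1, v}"
    by (rule proper_edge_coloring_neq[OF prop1 e1])
  \<comment> \<open>Two distinct colors cannot both equal the color of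
    \<open>{0, 1}\<close>.\<close>
  then obtain x where x: "x < 2" "A ws {x, v} \<noteq> A (ws @ zs) {0, 1}"
    by (metis one_less_numeral_iff pos2 semiring_norm(76))
  \<comment> \<open>The 4 in the hypothesis is \<open>x + 3\<close> for the larger root,
    \<open>x = 1\<close>.\<close>
  have "(x + 3) * d ^ k \<le> m + 2"
    using k x(1) mult_right_mono[of "x + 3" 4 "d ^ k"] by linarith
  from recoloring_path[OF assms(1) tc this r1(1)[OF x(1)] r2[OF x(1)] x(2) r1(2)[OF x(1)] r3]
  have "Suc k \<le> card {j \<in> {2..<2 + d * m}. x < j \<and> \<phi> j \<noteq> \<psi> j}" .
  also have "\<dots> \<le> card {e \<in> underlying (tree_pairs d v). A ws e \<noteq> A (ws @ zs) e}"
  proof (rule card_inj_on_le[where f = "\<lambda>j. {parent d j, j}"])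
    show "inj_on (\<lambda>j. {parent d j, j}) {j \<in> {2..<2 + d * m}. x < j \<and> \<phi> j \<noteq> \<psi> j}"
      using tree_edge_inj by (fastforce intro: inj_onI)
  qed (auto simp: \<phi>_def \<psi>_def underlying_def tree_pairs_def v)
  also have "total_recourse underlying A ws + \<dots> \<le> total_recourse underlying A (ws @ zs)"
  proof (rule card_changed_le_total_recourse)
    show "finite (underlying (state us))" for us
      by (rule finite_underlying_state)
    fix i assume "i \<le> length zs"
    then have "ws @ take i zs = us @ take (2 + i) (gadget v)"
      by (simp add: ws_def zs_def gadget_def take_Cons' min_def)
    then show "underlying (tree_pairs d v) \<subseteq> underlying (state (ws @ take i zs))"
      using st[of "2 + i"] by (auto simp: underlying_def)
  qed
  finally have "total_recourse underlying A ws + Suc k \<le> total_recourse underlying A (ws @ zs)"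
    by simp
  moreover have "total_recourse underlying A us \<le> total_recourse underlying A ws"
    unfolding ws_def by (rule total_recourse_mono)
  moreover have "total_recourse underlying A (ws @ zs) \<le> total_recourse underlying A (us @ gadget v)"
    using total_recourse_mono[of underlying A "us @ take 5 (gadget v)" "drop 5 (gadget v)"]
    unfolding ws_zs by simp
  ultimately show ?thesis by simp
qed

section \<open>Amortization and choice of parameters\<close>

lemma hard_sequence:
  fixes d m :: nat
  assumes "2 \<le> d" "v < n" and v: "v = 2 + d * m" and k: "4 * d ^ k \<le> m + 2"
  defines "us \<equiv> \<lambda>N. build d v @ concat (replicate N (gadget v))"
  shows "legal_seq (rooted_legal n (Suc d)) (us N) \<and> state (us N) = tree_pairs d v \<and>
    (\<forall>A. maintains_coloring (rooted_legal n (Suc d)) underlying (Suc d) A \<longrightarrow>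
      N * Suc k \<le> total_recourse underlying A (us N))"
\<comment> \<open>Every round starts from the same forest, and its cost bound holds whatever
  coloring the earlier rounds left behind.\<close>
proof (induction N)
  case 0
  then show ?case
    using build_legal[OF assms(1), of v n] assms(2) by (simp add: us_def)
next
  case (Suc N)
  have us_Suc: "us (Suc N) = us N @ gadget v"
    by (simp add: us_def flip: replicate_append_same)
  have "Suc N * Suc k \<le> total_recourse underlying A (us N @ gadget v)"
    if "maintains_coloring (rooted_legal n (Suc d)) underlying (Suc d) A" for A
    using gadget_recourse[OF assms(1,2) v k that, of "us N"] Suc that by auto
  then show ?case
    using Suc gadget_legal[OF assms(1,2) v] unfolding us_Suc by (simp add: legal_seq_append)
qed

text \<open>Building the trees takes \<open>d * m\<close> updates; \<open>d * m\<close> rounds of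
  six updates bring the total to seven times that, so the amortized recourse is at least
  \<open>Suc k / 7\<close>. With \<open>k + 5 \<le> 5 * Suc k\<close> as a bound on the logarithm
  this gives 1/35.\<close>

lemma rooted_lower_bound:
  fixes \<Delta> n :: nat
  assumes "3 \<le> \<Delta>" "7 * \<Delta> \<le> n"
  obtains us where "us \<noteq> []" "legal_seq (rooted_legal n \<Delta>) us"
    "\<And>A. maintains_coloring (rooted_legal n \<Delta>) underlying \<Delta> A \<Longrightarrow>
      1 / 35 * log (real \<Delta> - 1) (real n) \<le> amortized_recourse underlying A us"
proof -
  define d where "d = \<Delta> - 1"
  have d: "2 \<le> d" "\<Delta> = Suc d"
    using assms(1) by (auto simp: d_def)
  have "n < 7 * d ^ (n + 2)"
  proof -
    have "n < d ^ n"
      using d(1) by (intro power_gt_expt) auto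
    also have "\<dots> \<le> 7 * d ^ (n + 2)"
      using d(1) by (simp add: power_add)
    finally show ?thesis .
  qed
  then have ex: "\<exists>k. n < 7 * d ^ (k + 2)" ..
  \<comment> \<open>Minimality yields \<open>7 * d ^ (k + 1) \<le> n\<close>, which is room for both
    trees and \<open>v\<close>; for \<open>k = 0\<close> this comes from
    \<open>7 * \<Delta> \<le> n\<close> instead.\<close>
  define k where "k = (LEAST k. n < 7 * d ^ (k + 2))"
  have upper: "n < 7 * d ^ (k + 2)"
    unfolding k_def using ex by (rule LeastI_ex)
  have lower: "7 * d ^ (k + 1) \<le> n"
  proof (cases k)
    case 0
    then show ?thesis using assms(2) d by simp
  next
    case (Suc l)
    then have "\<not> n < 7 * d ^ (l + 2)"
      using not_less_Least[of l "\<lambda>k. n < 7 * d ^ (k + 2)"] k_def by simp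
    then show ?thesis using Suc by simp
  qed
  define m where "m = 4 * d ^ k"
  define v where "v = 2 + d * m"
  have dk: "1 \<le> d ^ k" using d(1) by simp
  have dm: "d * m = 4 * d ^ (k + 1)" by (simp add: m_def)
  have "2 \<le> d ^ (k + 1)"
    using mult_le_mono[OF d(1) dk] by simp
  then have vn: "v < n"
    using lower unfolding v_def dm by linarith
  define us where "us = build d v @ concat (replicate (d * m) (gadget v))"
  have "4 * d ^ k \<le> m + 2" by (simp add: m_def)
  note hard = hard_sequence[OF d(1) vn v_def this, of "d * m", folded us_def]
  have "length (build d v) = v - 2"
    by (simp add: build_def)
  then have len: "length us = 7 * (d * m)"
    by (simp add: us_def gadget_def v_def length_concat sum_list_replicate)
  have pos: "0 < d * m"
    using d(1) dk by (simp add: m_def)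
  \<comment> \<open>The factor 7 is absorbed into three further powers of \<open>d\<close>, as
    \<open>7 \<le> d ^ 3\<close>.\<close>
  have "real n \<le> real (d ^ (k + 5))"
  proof -
    have "7 \<le> d ^ 3"
      using power_mono[of 2 d 3] d(1) by simp
    then have "7 * d ^ (k + 2) \<le> d ^ 3 * d ^ (k + 2)"
      by simp
    also have "\<dots> = d ^ (k + 5)"
      by (simp only: power_add [symmetric]) (simp add: add.commute)
    finally show ?thesis using upper by linarith
  qed
  moreover have "0 < real n"
    using vn by simp
  ultimately have "log (real d) (real n) \<le> log (real d) (real d ^ (k + 5))"
    using d(1) by (intro log_mono) auto
  also have "\<dots> = real (k + 5)"
    using d(1) by (subst log_nat_power) auto
  also have "\<dots> \<le> 5 * real (Suc k)"
    by simp
  finally have log: "1 / 35 * log (real \<Delta> - 1) (real n) \<le> real (Suc k) / 7"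
    using d(2) by simp
  show thesis
  proof
    show "us \<noteq> []" using len pos by auto
    show "legal_seq (rooted_legal n \<Delta>) us" using hard d(2) by simp
    fix A assume "maintains_coloring (rooted_legal n \<Delta>) underlying \<Delta> A"
    then have "d * m * Suc k \<le> total_recourse underlying A us"
      using hard d(2) by simp
    then have "real (d * m) * real (Suc k) \<le> real (total_recourse underlying A us)"
      by (metis of_nat_le_iff of_nat_mult)
    then have "real (Suc k) / 7 \<le> amortized_recourse underlying A us"
      using pos unfolding amortized_recourse_eq len
      by (simp add: field_simps del: of_nat_Suc)
    with log show "1 / 35 * log (real \<Delta> - 1) (real n) \<le> amortized_recourse underlying A us"
      by linarith
  qed
qed

theorem theorem2p13:
  "\<exists>c::real. c > 0 \<and> (\<exists>K::nat. \<forall>\<Delta> n :: nat. \<Delta> \<ge> 3 \<and> n \<ge> K * \<Delta> \<longrightarrow>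
     (\<forall>A. maintains_coloring (forest_legal n \<Delta>) id \<Delta> A \<longrightarrow>
        (\<exists>us. us \<noteq> [] \<and> legal_seq (forest_legal n \<Delta>) us \<and>
           amortized_recourse id A us \<ge> c * log (real \<Delta> - 1) (real n))) \<and>
     (\<forall>M. randomized_maintains_coloring (forest_legal n \<Delta>) id \<Delta> M \<longrightarrow>
        (\<exists>us. us \<noteq> [] \<and> legal_seq (forest_legal n \<Delta>) us \<and>
           (\<integral>A. amortized_recourse id A us \<partial>M) \<ge> c * log (real \<Delta> - 1) (real n))) \<and>
     (\<forall>A. maintains_coloring (rooted_legal n \<Delta>) underlying \<Delta> A \<longrightarrow>
        (\<exists>us. us \<noteq> [] \<and> legal_seq (rooted_legal n \<Delta>) us \<and>
           amortized_recourse underlying A us \<ge> c * log (real \<Delta> - 1) (real n))) \<and>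
     (\<forall>M. randomized_maintains_coloring (rooted_legal n \<Delta>) underlying \<Delta> M \<longrightarrow>
        (\<exists>us. us \<noteq> [] \<and> legal_seq (rooted_legal n \<Delta>) us \<and>
           (\<integral>A. amortized_recourse underlying A us \<partial>M) \<ge> c * log (real \<Delta> - 1) (real n))))"
proof (intro exI[of _ "1 / 35 :: real"] exI[of _ "7 :: nat"] conjI allI impI)
  show "0 < (1 / 35 :: real)" by simp
next
  fix \<Delta> n :: nat
  assume "3 \<le> \<Delta> \<and> 7 * \<Delta> \<le> n"
  \<comment> \<open>The sequence is obtained before any algorithm is fixed, so it serves all four
    claims, the plain ones through \<open>unroot\<close>.\<close>
  then obtain us where us: "us \<noteq> []" "legal_seq (rooted_legal n \<Delta>) us"
    and bound: "\<And>A. maintains_coloring (rooted_legal n \<Delta>) underlying \<Delta> A \<Longrightarrow>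
      1 / 35 * log (real \<Delta> - 1) (real n) \<le> amortized_recourse underlying A us"
    using rooted_lower_bound[of \<Delta> n] by blast
  have us': "unroot us \<noteq> []" "legal_seq (forest_legal n \<Delta>) (unroot us)"
    using us rooted_legal_unroot by auto
  have bound': "1 / 35 * log (real \<Delta> - 1) (real n) \<le> amortized_recourse id A (unroot us)"
    if "maintains_coloring (forest_legal n \<Delta>) id \<Delta> A" for A
    using bound[OF maintains_coloring_unroot[OF that]] amortized_recourse_unroot[OF us(2)] by simp
  {
    fix A assume "maintains_coloring (forest_legal n \<Delta>) id \<Delta> A"
    then show "\<exists>us. us \<noteq> [] \<and> legal_seq (forest_legal n \<Delta>) us \<and>
        1 / 35 * log (real \<Delta> - 1) (real n) \<le> amortized_recourse id A us"
      using us' bound' by blast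
  next
    fix M assume "randomized_maintains_coloring (forest_legal n \<Delta>) id \<Delta> M"
    from randomized_lower_bound[OF this us'(2) _ bound']
    show "\<exists>us. us \<noteq> [] \<and> legal_seq (forest_legal n \<Delta>) us \<and>
        1 / 35 * log (real \<Delta> - 1) (real n) \<le> (\<integral>A. amortized_recourse id A us \<partial>M)"
      using us' finite_state by (metis id_apply)
  next
    fix A assume "maintains_coloring (rooted_legal n \<Delta>) underlying \<Delta> A"
    then show "\<exists>us. us \<noteq> [] \<and> legal_seq (rooted_legal n \<Delta>) us \<and>
        1 / 35 * log (real \<Delta> - 1) (real n) \<le> amortized_recourse underlying A us"
      using us bound by blast
  next
    fix M assume "randomized_maintains_coloring (rooted_legal n \<Delta>) underlying \<Delta> M"
    from randomized_lower_bound[OF this us(2) finite_underlying_state bound]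
    show "\<exists>us. us \<noteq> [] \<and> legal_seq (rooted_legal n \<Delta>) us \<and>
        1 / 35 * log (real \<Delta> - 1) (real n) \<le> (\<integral>A. amortized_recourse underlying A us \<partial>M)"
      using us by blast
  }
qed

end
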